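(* Suppose that the spectral radius $\alpha(P)$ of the $N\times N$ matrix $P$ is strictly less than $1$, and that the timing of the asynchronous iterative algorithm satisfies: for each Agent $j$ and each iteration time $t$ there exists $t'>t$ such that between $t$ and $t'$ Agent $j$ does at least one computation and does a transmission to every other agent. For $j=1,\dots,N$, let $\boldsymbol{\gamma}^{(0)}(j)\in\boldsymbol{\Gamma}$ be the (arbitrary) initial memory content of Agent $j$. For each $t$, let $\boldsymbol{\gamma}^{(t)}$ be defined by $\gamma_j^{(t)}=\gamma_j^{(t)}(j)$, $j=1,\dots,N$. Then the asynchronous iterative algorithm converges to the unique fixed point $\boldsymbol{\gamma}^*$ of $\mathsf{B}$, that is, $$\lim_{t\to\infty}\|\boldsymbol{\gamma}^{(t)}-\boldsymbol{\gamma}^*\|=0.$$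
   Context: Team model. There are $N$ agents. $\mathsf{X}$ is a Borel space (Borel subset of a complete separable metric space) with a Borel probability measure $\mathbb{P}$. For $i=1,\dots,N$, $\mathsf{U}_i$ and $\mathsf{Y}_i$ are nonempty finite sets (actions and observations of Agent $i$), and $W_i(\cdot\mid x,\mathbf{u}^{(1:i-1)})$ is a conditional probability (stochastic kernel) on $\mathsf{Y}_i$ given $\mathsf{X}\times\prod_{k=1}^{i-1}\mathsf{U}_k$. The reward function $p:\mathsf{X}\times\prod_i\mathsf{Y}_i\times\prod_i\mathsf{U}_i\to[0,\infty)$ is measurable. Put $\mathbf{y}=(y_1,\dots,y_N)$, $\mathbf{u}=(u_1,\dots,u_N)$, and a superscript $-j$ means that the $j$-th component is removed. Define $$r(\mathbf{y},\mathbf{u})=\int_{\mathsf{X}}p(x,\mathbf{y},\mathbf{u})\prod_{i=1}^N|\mathsf{Y}_i|\,W_i(y_i\mid x,\mathbf{u}^{(1:i-1)})\,\mathbb{P}(dx),$$ assumed finite, and let $\pi_i$ be the uniform distribution on $\mathsf{Y}_i$. $\Delta_i\subset\mathbb{R}^{\mathsf{U}_i}$ is the set of probability distributions on $\mathsf{U}_i$. A policy of Agent $i$ is a function $\gamma_i:\mathsf{Y}_i\to\Delta_i$, also written $\gamma_i(u_i\mid y_i)$. $\Gamma_i$ is the set of such policies, and $\boldsymbol{\Gamma}=\prod_{i=1}^N\Gamma_i$. For $\boldsymbol{\gamma}\in\boldsymbol{\Gamma}$ let $\boldsymbol{\gamma}(\mathbf{y})=(\gamma_1(y_1),\dots,\gamma_N(y_N))$.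 For $\boldsymbol{\delta}=(\delta_1,\dots,\delta_N)\in\prod_i\Delta_i$ let $R(\mathbf{y},\boldsymbol{\delta})=\sum_{\mathbf{u}}r(\mathbf{y},\mathbf{u})\prod_{i=1}^N\delta_i(u_i)$. Regularization. For each $i$, $\rho_i>0$ and $\Omega_i:\Delta_i\to\mathbb{R}$ is convex and $\rho_i$-strongly convex with respect to the $\ell_1$-norm $\|\cdot\|_1$ on $\mathbb{R}^{\mathsf{U}_i}$: extending $\Omega_i$ by $+\infty$ outside $\Delta_i$, for all $\delta,\delta'\in\Delta_i$ and every subgradient $z\in\partial\Omega_i(\delta)$, $\Omega_i(\delta')\ge\Omega_i(\delta)+\langle z,\delta'-\delta\rangle+\frac{\rho_i}{2}\|\delta'-\delta\|_1^2$. Best response. For each $j$, $\mathsf{B}_j$ maps $\boldsymbol{\gamma}^{-j}=(\gamma_i)_{i\ne j}$ to the policy in $\Gamma_j$ given by $$\mathsf{B}_j(\boldsymbol{\gamma}^{-j})(y_j)=\operatorname*{arg\,max}_{\delta_j\in\Delta_j}\Big[\sum_{\mathbf{y}^{-j}}R(\mathbf{y},\boldsymbol{\gamma}^{-j}(\mathbf{y}^{-j}),\delta_j)\prod_{i\ne j}\pi_i(y_i)-\Omega_j(\delta_j)\Big].$$ As a standing convention this maximizer exists and is unique, so $\mathsf{B}_j$ is single-valued. The best response operator $\mathsf{B}:\boldsymbol{\Gamma}\to\boldsymbol{\Gamma}$ is $\mathsf{B}(\boldsymbol{\gamma})=(\mathsf{B}_1(\boldsymbol{\gamma}^{-1}),\dots,\mathsf{B}_N(\boldsymbol{\gamma}^{-N}))$.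 Norms. $\|\gamma_i\|_{L_1}=\sum_{y_i}\|\gamma_i(\cdot\mid y_i)\|_1\,\pi_i(y_i)$ on $\mathbb{R}^{\mathsf{U}_i\times\mathsf{Y}_i}$, and $\|\boldsymbol{\gamma}\|=(\|\gamma_1\|_{L_1},\dots,\|\gamma_N\|_{L_1})^T$ is a vector in $\mathbb{R}^N$ (convergence to $0$ is componentwise). Matrix $P$. $\lambda_j(r)=\sup_{\mathbf{y},\mathbf{u}^{-j}}\big[\sup_{u_j}r(\mathbf{y},\mathbf{u})-\inf_{u_j}r(\mathbf{y},\mathbf{u})\big]$. $P(j,i)=\frac{1}{\rho_j}\frac{\lambda_i(r)}{2}$ for $i\ne j$ and $P(j,j)=0$. Asynchronous iterative algorithm. At each discrete iteration time $t=0,1,2,\dots$ every Agent $j$ stores in memory an $N$-tuple of policies $\boldsymbol{\gamma}^{(t)}(j)=(\gamma_1^{(t)}(j),\dots,\gamma_N^{(t)}(j))\in\boldsymbol{\Gamma}$, where $\gamma_i^{(t)}(j)$, $i\neq j$, is the latest transmission received from Agent $i$ (or the initial content) and $\gamma_j^{(t)}(j)$ is Agent $j$'s latest own policy estimate. Memory contents of different agents may differ, including at time $0$. At each iteration $t\ge1$ each agent is in one of three states: compute, transmit (to one or more other agents), or idle; an agent can receive transmissions while computing or transmitting. Update rules: (1) if $t$ is a transmission time from Agent $i$ to Agent $j$, then $\gamma_i^{(t)}(j)=\gamma_i^{(t-1)}(i)$; (2) if $t$ is a computation time for Agent $i$, then $\gamma_i^{(t)}(i)=\mathsf{B}_i\big(\gamma_1^{(t-1)}(i),\dots,\gamma_{i-1}^{(t-1)}(i),\gamma_{i+1}^{(t-1)}(i),\dots,\gamma_N^{(t-1)}(i)\big)$.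 All memory entries not affected by these rules at time $t$ remain as at time $t-1$. *)

theory Defs
  imports "HOL-Probability.Probability" "Jordan_Normal_Form.Spectral_Radius"
begin

no_notation Matrix.vec_index (infixl "$" 100)

section \<open>Convex analysis\<close>

definition extend_inf :: "'a set \<Rightarrow> ('a \<Rightarrow> real) \<Rightarrow> 'a \<Rightarrow> ereal" where
  "extend_inf S f x = (if x \<in> S then ereal (f x) else \<infinity>)"

definition subdifferential :: "('a::real_inner \<Rightarrow> ereal) \<Rightarrow> 'a \<Rightarrow> 'a set" where
  "subdifferential f x = {z. \<forall>y. f y \<ge> f x + ereal (inner z (y - x))}"

definition l1_norm :: "real ^ 'u::finite \<Rightarrow> real" where
  "l1_norm v = (\<Sum>a\<in>UNIV. \<bar>v $ a\<bar>)"

definition l1_strongly_convex_on :: "real \<Rightarrow> (real ^ 'u::finite) set \<Rightarrow> (real ^ 'u \<Rightarrow> real) \<Rightarrow> bool" where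
  "l1_strongly_convex_on c S f \<longleftrightarrow>
     (\<forall>\<delta>\<in>S. \<forall>\<delta>'\<in>S. \<forall>z\<in>subdifferential (extend_inf S f) \<delta>.
        f \<delta>' \<ge> f \<delta> + inner z (\<delta>' - \<delta>) + c / 2 * (l1_norm (\<delta>' - \<delta>))\<^sup>2)"

section \<open>The team\<close>

text \<open>
  The agents are \<open>0, \<dots>, N - 1\<close> where \<open>N\<close> is \<open>num_agents T\<close>, in the order in which they act.
  The action sets of the agents are subsets of one finite type \<open>'u\<close>; the space of real
  vectors indexed by the actions of Agent \<open>i\<close> is identified with the vectors in
  \<open>real ^ 'u\<close> that vanish off \<open>actions T i\<close>. All tuples indexed by agents, and all policies
  as functions of the observation, are extensional functions (\<open>undefined\<close> off the index set).
  The state space is \<open>space (prior T)\<close>.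
\<close>

record ('x, 'y, 'u) team =
  num_agents :: nat
  prior :: "'x measure"
  actions :: "nat \<Rightarrow> 'u set"
  observations :: "nat \<Rightarrow> 'y set"
  obs_kernel :: "nat \<Rightarrow> 'x \<times> (nat \<Rightarrow> 'u) \<Rightarrow> 'y measure"
  reward :: "'x \<times> (nat \<Rightarrow> 'y) \<times> (nat \<Rightarrow> 'u) \<Rightarrow> real"
  regularizer :: "nat \<Rightarrow> (real ^ 'u) \<Rightarrow> real"
  reg_modulus :: "nat \<Rightarrow> real"

definition agents :: "('x, 'y, 'u::finite) team \<Rightarrow> nat set" where
  "agents T = {..<num_agents T}"

definition others :: "('x, 'y, 'u::finite) team \<Rightarrow> nat \<Rightarrow> nat set" where
  "others T j = agents T - {j}"

definition obs_profiles :: "('x, 'y, 'u::finite) team \<Rightarrow> (nat \<Rightarrow> 'y) set" where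
  "obs_profiles T = PiE (agents T) (observations T)"

definition action_profiles :: "('x, 'y, 'u::finite) team \<Rightarrow> (nat \<Rightarrow> 'u) set" where
  "action_profiles T = PiE (agents T) (actions T)"

definition obs_dist :: "('x, 'y, 'u::finite) team \<Rightarrow> nat \<Rightarrow> 'y pmf" where
  "obs_dist T i = pmf_of_set (observations T i)"

definition reward_integrand ::
  "('x, 'y, 'u::finite) team \<Rightarrow> (nat \<Rightarrow> 'y) \<Rightarrow> (nat \<Rightarrow> 'u) \<Rightarrow> 'x \<Rightarrow> real" where
  "reward_integrand T y u x =
     reward T (x, y, u) *
     (\<Prod>i\<in>agents T. real (card (observations T i)) *
                   measure (obs_kernel T i (x, restrict u {..<i})) {y i})"

definition avg_reward :: "('x, 'y, 'u::finite) team \<Rightarrow> (nat \<Rightarrow> 'y) \<Rightarrow> (nat \<Rightarrow> 'u) \<Rightarrow> real" where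
  "avg_reward T y u = (\<integral>x. reward_integrand T y u x \<partial>prior T)"

text \<open>
  Given that the reward is nonnegative and measurable, finiteness of the integral defining
  \<open>avg_reward\<close> is integrability.
\<close>

definition team_model :: "('x::polish_space, 'y, 'u::finite) team \<Rightarrow> bool" where
  "team_model T \<longleftrightarrow>
     num_agents T > 0 \<and>
     space (prior T) \<in> sets borel \<and>
     sets (prior T) = sets (restrict_space borel (space (prior T))) \<and>
     prob_space (prior T) \<and>
     (\<forall>i\<in>agents T. finite (actions T i) \<and> actions T i \<noteq> {} \<and>
                   finite (observations T i) \<and> observations T i \<noteq> {}) \<and>
     (\<forall>i\<in>agents T. obs_kernel T i \<in>
        prior T \<Otimes>\<^sub>M (\<Pi>\<^sub>M k\<in>{..<i}. count_space (actions T k))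
          \<rightarrow>\<^sub>M prob_algebra (count_space (observations T i))) \<and>
     reward T \<in> borel_measurable
       (prior T \<Otimes>\<^sub>M (\<Pi>\<^sub>M i\<in>agents T. count_space (observations T i))
                \<Otimes>\<^sub>M (\<Pi>\<^sub>M i\<in>agents T. count_space (actions T i))) \<and>
     (\<forall>x\<in>space (prior T). \<forall>y\<in>obs_profiles T. \<forall>u\<in>action_profiles T. reward T (x, y, u) \<ge> 0) \<and>
     (\<forall>y\<in>obs_profiles T. \<forall>u\<in>action_profiles T. integrable (prior T) (reward_integrand T y u))"

section \<open>Policies and best responses\<close>

definition mixed_actions :: "('x, 'y, 'u::finite) team \<Rightarrow> nat \<Rightarrow> (real ^ 'u) set" where
  "mixed_actions T i =
     {\<delta>. (\<forall>a. \<delta> $ a \<ge> 0) \<and> (\<forall>a. a \<notin> actions T i \<longrightarrow> \<delta> $ a = 0) \<and> (\<Sum>a\<in>actions T i. \<delta> $ a) = 1}"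

definition policies :: "('x, 'y, 'u::finite) team \<Rightarrow> nat \<Rightarrow> ('y \<Rightarrow> real ^ 'u) set" where
  "policies T i = observations T i \<rightarrow>\<^sub>E mixed_actions T i"

definition policy_profiles :: "('x, 'y, 'u::finite) team \<Rightarrow> (nat \<Rightarrow> 'y \<Rightarrow> real ^ 'u) set" where
  "policy_profiles T = PiE (agents T) (policies T)"

definition regularized :: "('x, 'y, 'u::finite) team \<Rightarrow> bool" where
  "regularized T \<longleftrightarrow>
     (\<forall>i\<in>agents T. reg_modulus T i > 0 \<and>
        convex_on (mixed_actions T i) (regularizer T i) \<and>
        l1_strongly_convex_on (reg_modulus T i) (mixed_actions T i) (regularizer T i))"

definition mixed_reward ::
  "('x, 'y, 'u::finite) team \<Rightarrow> (nat \<Rightarrow> 'y) \<Rightarrow> (nat \<Rightarrow> real ^ 'u) \<Rightarrow> real" where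
  "mixed_reward T y \<delta> = (\<Sum>u\<in>action_profiles T. avg_reward T y u * (\<Prod>i\<in>agents T. \<delta> i $ u i))"

definition response_objective ::
  "('x, 'y, 'u::finite) team \<Rightarrow> nat \<Rightarrow> (nat \<Rightarrow> 'y \<Rightarrow> real ^ 'u) \<Rightarrow> 'y \<Rightarrow> real ^ 'u \<Rightarrow> real" where
  "response_objective T j g b \<delta> =
     (\<Sum>y\<in>PiE (others T j) (observations T).
        mixed_reward T (y(j := b)) ((\<lambda>i\<in>others T j. g i (y i))(j := \<delta>)) *
        (\<Prod>i\<in>others T j. pmf (obs_dist T i) (y i)))
     - regularizer T j \<delta>"

definition best_response ::
  "('x, 'y, 'u::finite) team \<Rightarrow> nat \<Rightarrow> (nat \<Rightarrow> 'y \<Rightarrow> real ^ 'u) \<Rightarrow> 'y \<Rightarrow> real ^ 'u" where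
  "best_response T j g =
     (\<lambda>b\<in>observations T j. arg_max (response_objective T j g b) (\<lambda>\<delta>. \<delta> \<in> mixed_actions T j))"

definition unique_best_responses :: "('x, 'y, 'u::finite) team \<Rightarrow> bool" where
  "unique_best_responses T \<longleftrightarrow>
     (\<forall>j\<in>agents T. \<forall>g\<in>PiE (others T j) (policies T). \<forall>b\<in>observations T j.
        \<exists>!\<delta>. is_arg_max (response_objective T j g b) (\<lambda>\<delta>. \<delta> \<in> mixed_actions T j) \<delta>)"

definition best_response_operator ::
  "('x, 'y, 'u::finite) team \<Rightarrow> (nat \<Rightarrow> 'y \<Rightarrow> real ^ 'u) \<Rightarrow> (nat \<Rightarrow> 'y \<Rightarrow> real ^ 'u)" where
  "best_response_operator T \<gamma> = (\<lambda>j\<in>agents T. best_response T j (restrict \<gamma> (others T j)))"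

section \<open>Norms and the matrix of the contraction condition\<close>

definition policy_norm :: "('x, 'y, 'u::finite) team \<Rightarrow> nat \<Rightarrow> ('y \<Rightarrow> real ^ 'u) \<Rightarrow> real" where
  "policy_norm T i g = (\<Sum>b\<in>observations T i. l1_norm (g b) * pmf (obs_dist T i) b)"

text \<open>The vector-valued norm, as a function of the component.\<close>

definition profile_norm ::
  "('x, 'y, 'u::finite) team \<Rightarrow> (nat \<Rightarrow> 'y \<Rightarrow> real ^ 'u) \<Rightarrow> nat \<Rightarrow> real" where
  "profile_norm T \<gamma> = (\<lambda>i\<in>agents T. policy_norm T i (\<gamma> i))"

definition reward_oscillation :: "('x, 'y, 'u::finite) team \<Rightarrow> nat \<Rightarrow> real" where
  "reward_oscillation T j =
     (SUP (y, v) \<in> obs_profiles T \<times> PiE (others T j) (actions T).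
        (SUP a\<in>actions T j. avg_reward T y (v(j := a))) -
        (INF a\<in>actions T j. avg_reward T y (v(j := a))))"

definition sensitivity_matrix :: "('x, 'y, 'u::finite) team \<Rightarrow> real mat" where
  "sensitivity_matrix T = Matrix.mat (num_agents T) (num_agents T)
     (\<lambda>(j, i). if i = j then 0 else 1 / reg_modulus T j * (reward_oscillation T i / 2))"

section \<open>The asynchronous iterative algorithm\<close>

text \<open>
  \<open>Transmit D\<close> is a transmission to every agent in \<open>D\<close>. A schedule gives the state of each
  agent at each time \<open>t \<ge> 1\<close>; its values at time 0 play no role.
\<close>

datatype agent_state = Compute | Transmit "nat set" | Idle

definition valid_schedule ::
  "('x, 'y, 'u::finite) team \<Rightarrow> (nat \<Rightarrow> nat \<Rightarrow> agent_state) \<Rightarrow> bool" where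
  "valid_schedule T s \<longleftrightarrow>
     (\<forall>t\<ge>1. \<forall>i\<in>agents T. \<forall>D. s t i = Transmit D \<longrightarrow> D \<noteq> {} \<and> D \<subseteq> others T i)"

definition computes_at :: "(nat \<Rightarrow> nat \<Rightarrow> agent_state) \<Rightarrow> nat \<Rightarrow> nat \<Rightarrow> bool" where
  "computes_at s t i \<longleftrightarrow> s t i = Compute"

definition transmits_at :: "(nat \<Rightarrow> nat \<Rightarrow> agent_state) \<Rightarrow> nat \<Rightarrow> nat \<Rightarrow> nat \<Rightarrow> bool" where
  "transmits_at s t i j \<longleftrightarrow> (\<exists>D. s t i = Transmit D \<and> j \<in> D)"

text \<open>\<open>memory T s m0 t j i\<close> is the policy of Agent \<open>i\<close> stored by Agent \<open>j\<close> at time \<open>t\<close>.\<close>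

primrec memory ::
  "('x, 'y, 'u::finite) team \<Rightarrow> (nat \<Rightarrow> nat \<Rightarrow> agent_state) \<Rightarrow>
   (nat \<Rightarrow> nat \<Rightarrow> 'y \<Rightarrow> real ^ 'u) \<Rightarrow> nat \<Rightarrow> nat \<Rightarrow> nat \<Rightarrow> 'y \<Rightarrow> real ^ 'u" where
  "memory T s m0 0 = m0"
| "memory T s m0 (Suc t) = (\<lambda>j. \<lambda>i\<in>agents T.
     if i = j then
       (if computes_at s (Suc t) j
        then best_response T j (restrict (memory T s m0 t j) (others T j))
        else memory T s m0 t j j)
     else
       (if transmits_at s (Suc t) i j then memory T s m0 t i i else memory T s m0 t j i))"

definition current_profile ::
  "('x, 'y, 'u::finite) team \<Rightarrow> (nat \<Rightarrow> nat \<Rightarrow> agent_state) \<Rightarrow>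
   (nat \<Rightarrow> nat \<Rightarrow> 'y \<Rightarrow> real ^ 'u) \<Rightarrow> nat \<Rightarrow> nat \<Rightarrow> 'y \<Rightarrow> real ^ 'u" where
  "current_profile T s m0 t = (\<lambda>j\<in>agents T. memory T s m0 t j j)"

definition recurrent_schedule ::
  "('x, 'y, 'u::finite) team \<Rightarrow> (nat \<Rightarrow> nat \<Rightarrow> agent_state) \<Rightarrow> bool" where
  "recurrent_schedule T s \<longleftrightarrow>
     (\<forall>j\<in>agents T. \<forall>t. \<exists>t'>t.
        (\<exists>\<tau>\<in>{t<..t'}. computes_at s \<tau> j) \<and>
        (\<forall>k\<in>others T j. \<exists>\<tau>\<in>{t<..t'}. transmits_at s \<tau> j k))"

end

theory Submission
  imports Defs
begin

text \<open>
  The iteration converges because the best response operator contracts a weighted maximum norm,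
  and a contraction of a maximum norm tolerates outdated information.

  The objective of an agent is a linear payoff, determined by the policies of the others, minus
  a regularizer that is strongly convex in the \<open>\<ell>\<^sub>1\<close>-norm. Payoff vectors are subgradients of the
  regularizer at the maximizers, so strong convexity makes the maximizer a Lipschitz function
  of the payoff vector with constant \<open>1 / \<rho>\<^sub>j\<close> (\<open>l1_strongly_convex_arg_max_stable\<close>). The payoff
  vector is an average over independent actions of the other agents; exchanging the policy of
  Agent \<open>i\<close> changes it by at most half the oscillation of the reward in the action of Agent
  \<open>i\<close> times the change of the policy (\<open>product_weights_diff_le\<close>). Together, deviations of the
  policies by at most \<open>d\<close> cause deviations of the best responses by at most \<open>P d\<close>
  (\<open>best_response_lipschitz\<close>), where \<open>P\<close> is the sensitivity matrix.

  As \<open>P\<close> is nonnegative with spectral radius below one, there are positive weights \<open>w\<close> with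
  \<open>P w \<le> c w\<close> for some \<open>c < 1\<close> (\<open>spectral_radius_less_1_weights\<close>). Hence, if two policy
  profiles differ by at most \<open>M w\<^sub>i\<close> for every Agent \<open>i\<close>, then their best responses differ by
  at most \<open>c M w\<^sub>j\<close> for every Agent \<open>j\<close> (\<open>best_response_close\<close>), which
  gives existence and uniqueness of the fixed point by iteration.

  For the asynchronous iteration, consider the nested boxes of radii \<open>2 c\<^sup>k w\<^sub>i\<close> around
  the fixed point. All memories start in the box for \<open>k = 0\<close>. Once all memories are in one box,
  any computation lands in the next one, whatever mixture of old and new entries it uses;
  after every agent has computed and then transmitted to every other agent, all memories are in
  the next box for good (\<open>eventually_memory_close_step\<close>).
\<close>

section \<open>Weights from a spectral radius below one\<close>

lemma smult_mat_mult_vec: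
  assumes "A \<in> carrier_mat m n" and "v \<in> carrier_vec n"
  shows "(c \<cdot>\<^sub>m A) *\<^sub>v v = c \<cdot>\<^sub>v (A *\<^sub>v v)"
  using assms by (intro eq_vecI) (auto simp: scalar_prod_def sum_distrib_left mult_ac)

lemma spectral_radius_smult_less:
  fixes A :: "complex mat"
  assumes A: "A \<in> carrier_mat n n" and n: "n > 0"
    and q: "0 < q" "spectral_radius A < q"
  shows "spectral_radius (complex_of_real (1 / q) \<cdot>\<^sub>m A) < 1"
proof -
  let ?B = "complex_of_real (1 / q) \<cdot>\<^sub>m A"
  have B: "?B \<in> carrier_mat n n" using A by simp
  obtain ev where ev: "ev \<in> spectrum ?B" and r: "spectral_radius ?B = norm ev"
    using spectral_radius_mem_max(1)[OF B n] by auto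
  from ev obtain v where v: "eigenvector ?B v ev"
    unfolding spectrum_def eigenvalue_def by auto
  have vc: "v \<in> carrier_vec n" using v A unfolding eigenvector_def by auto
  have "of_real (1 / q) \<cdot>\<^sub>v (A *\<^sub>v v) = ev \<cdot>\<^sub>v v"
    using v smult_mat_mult_vec[OF A vc] unfolding eigenvector_def by metis
  hence "of_real q \<cdot>\<^sub>v (of_real (1 / q) \<cdot>\<^sub>v (A *\<^sub>v v)) = of_real q \<cdot>\<^sub>v (ev \<cdot>\<^sub>v v)" by simp
  moreover have "complex_of_real q * of_real (1 / q) = 1" using q by simp
  ultimately have "A *\<^sub>v v = (of_real q * ev) \<cdot>\<^sub>v v"
    by (metis one_smult_vec smult_smult_assoc)
  hence "eigenvector A v (of_real q * ev)"
    using v A unfolding eigenvector_def by auto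
  hence "norm (of_real q * ev) \<in> norm ` spectrum A"
    unfolding spectrum_def eigenvalue_def by auto
  hence "norm (of_real q * ev) \<le> spectral_radius A" by (rule spectral_radius_mem_max(2)[OF A n])
  moreover have "norm (of_real q * ev) = q * norm ev" using q by (simp add: norm_mult)
  ultimately have "q * norm ev < q * 1" using q by linarith
  thus ?thesis unfolding r mult_less_cancel_left_pos[OF q(1)] .
qed

text \<open>
  The matrix acts on real functions of the index so that iterates, sums and inequalities stay
  over the reals; spectral theory takes place in complex vectors, to which
  \<open>scaled_mat_pow_mult_vec\<close> translates.
\<close>

definition mat_op :: "real mat \<Rightarrow> (nat \<Rightarrow> real) \<Rightarrow> nat \<Rightarrow> real" where
  "mat_op P f i = (\<Sum>j<dim_col P. P $$ (i, j) * f j)"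

lemma scaled_mat_pow_mult_vec:
  assumes P: "P \<in> carrier_mat n n"
  shows "(complex_of_real c \<cdot>\<^sub>m map_mat complex_of_real P) ^\<^sub>m k *\<^sub>v Matrix.vec n (\<lambda>i. complex_of_real (f i))
    = Matrix.vec n (\<lambda>i. complex_of_real (c ^ k * (mat_op P ^^ k) f i))"
proof (induction k arbitrary: f)
  case 0
  show ?case using P by (simp add: carrier_matD)
next
  case (Suc k)
  let ?A = "complex_of_real c \<cdot>\<^sub>m map_mat complex_of_real P"
  let ?v = "\<lambda>f. Matrix.vec n (\<lambda>i. complex_of_real (f i))"
  have A: "?A \<in> carrier_mat n n" using P by simp
  have step: "?A *\<^sub>v ?v f = ?v (\<lambda>i. c * mat_op P f i)"
  proof
    fix i assume "i < dim_vec (?v (\<lambda>i. c * mat_op P f i))"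
    thus "vec_index (?A *\<^sub>v ?v f) i = vec_index (?v (\<lambda>i. c * mat_op P f i)) i"
      using P by (auto simp: scalar_prod_def mat_op_def sum_distrib_left lessThan_atLeast0
          intro!: sum.cong)
  qed (use P in auto)
  have lin: "(mat_op P ^^ k) (\<lambda>i. c * g i) i = c * (mat_op P ^^ k) g i" for g i
    by (induction k arbitrary: i) (auto simp: mat_op_def sum_distrib_left mult_ac)
  have "?A ^\<^sub>m Suc k *\<^sub>v ?v f = ?A ^\<^sub>m k *\<^sub>v (?A *\<^sub>v ?v f)"
    using assoc_mult_mat_vec[OF pow_carrier_mat[OF A] A, of "?v f" k] by simp
  also have "\<dots> = ?v (\<lambda>i. c ^ Suc k * (mat_op P ^^ Suc k) f i)"
    unfolding step Suc.IH lin funpow_Suc_right by (simp add: mult_ac)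
  finally show ?case .
qed

lemma mat_op_pow_nonneg:
  assumes P: "P \<in> carrier_mat n n" and nn: "\<And>i j. i < n \<Longrightarrow> j < n \<Longrightarrow> 0 \<le> P $$ (i, j)"
    and f: "\<And>i. i < n \<Longrightarrow> 0 \<le> f i" and "i < n"
  shows "0 \<le> (mat_op P ^^ k) f i"
  using \<open>i < n\<close>
proof (induction k arbitrary: i)
  case (Suc k)
  thus ?case using P nn by (auto simp: mat_op_def intro!: sum_nonneg mult_nonneg_nonneg)
qed (use f in simp)

text \<open>
  A spectral radius below one bounds the powers of a matrix by a constant. Dividing the matrix
  by some \<open>q\<close> strictly between its spectral radius and one keeps the spectral radius below one,
  so the powers of the original matrix are bounded by a constant times \<open>q ^ k\<close>.
\<close>

lemma mat_op_pow_tendsto_0: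
  assumes P: "P \<in> carrier_mat n n" and n: "n > 0"
    and r: "spectral_radius (map_mat complex_of_real P) < 1" and i: "i < n"
  shows "(\<lambda>k. (mat_op P ^^ k) f i) \<longlonglongrightarrow> 0"
proof -
  let ?A = "map_mat complex_of_real P"
  have A: "?A \<in> carrier_mat n n" using P by simp
  have "0 \<le> spectral_radius ?A" using spectral_radius_mem_max(1)[OF A n] by auto
  then obtain q where q: "spectral_radius ?A < q" "q < 1" "0 < q"
    using r dense by (metis le_less_trans)
  let ?B = "complex_of_real (1 / q) \<cdot>\<^sub>m ?A"
  have B: "?B \<in> carrier_mat n n" using A by simp
  obtain C where C: "\<And>k. norm_bound (?B ^\<^sub>m k) C"
    using spectral_radius_jnf_norm_bound_less_1_upper_triangular[OF B
        spectral_radius_smult_less[OF A n q(3,1)]] by auto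
  have mult_vec_index: "vec_index (M *\<^sub>v Matrix.vec n g) i = (\<Sum>j<n. M $$ (i, j) * g j)"
    if "M \<in> carrier_mat n n" "i < n" for M and g :: "nat \<Rightarrow> complex" and i
    using that by (auto simp: scalar_prod_def lessThan_atLeast0 intro!: sum.cong)
  have bound: "norm ((mat_op P ^^ k) f i) \<le> (\<Sum>j<n. C * \<bar>f j\<bar>) * q ^ k" for k
  proof -
    have Bk: "?B ^\<^sub>m k \<in> carrier_mat n n" using pow_carrier_mat[OF B] .
    have entry: "norm ((?B ^\<^sub>m k) $$ (i, j)) \<le> C" if "j < n" for j
      using C[of k] i that carrier_matD[OF Bk] unfolding norm_bound_def by metis
    have "complex_of_real ((1 / q) ^ k * (mat_op P ^^ k) f i)
        = vec_index (?B ^\<^sub>m k *\<^sub>v Matrix.vec n (\<lambda>i. complex_of_real (f i))) i"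
      unfolding scaled_mat_pow_mult_vec[OF P] using i by simp
    also have "\<dots> = (\<Sum>j<n. (?B ^\<^sub>m k) $$ (i, j) * of_real (f j))"
      by (rule mult_vec_index[OF Bk i])
    finally have "norm (complex_of_real ((1 / q) ^ k * (mat_op P ^^ k) f i))
        \<le> (\<Sum>j<n. norm ((?B ^\<^sub>m k) $$ (i, j) * complex_of_real (f j)))" 
      by (metis norm_sum)
    also have "\<dots> \<le> (\<Sum>j<n. C * \<bar>f j\<bar>)"
      using entry by (auto simp: norm_mult intro!: sum_mono mult_right_mono)
    finally have "\<bar>(mat_op P ^^ k) f i\<bar> / q ^ k \<le> (\<Sum>j<n. C * \<bar>f j\<bar>)"
      unfolding norm_of_real using q(3) by (simp add: abs_mult power_one_over)
    thus ?thesis using q(3) by (simp add: pos_divide_le_eq)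
  qed
  have "(\<lambda>k. (\<Sum>j<n. C * \<bar>f j\<bar>) * q ^ k) \<longlonglongrightarrow> 0"
    using q by (intro tendsto_mult_right_zero LIMSEQ_power_zero) auto
  thus ?thesis by (rule Lim_null_comparison[rotated]) (use bound in auto)
qed

text \<open>
  The weights stand in for a Perron eigenvector, which may have zero entries. Choose \<open>m\<close> with
  \<open>P ^ m\<close> applied to the all-ones vector at most \<open>1 / 2\<close>, and let \<open>w\<close> be the sum of the vectors
  \<open>P ^ k 1\<close> over \<open>k < m\<close>. Telescoping gives \<open>P w = w - 1 + P ^ m 1 \<le> w - 1 / 2\<close>, and since the
  entries of \<open>w\<close> are bounded, the loss of \<open>1 / 2\<close> is at least a fixed fraction of \<open>w\<close>.
\<close>

lemma spectral_radius_less_1_weights: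
  assumes P: "P \<in> carrier_mat n n" and n: "n > 0"
    and nn: "\<And>i j. i < n \<Longrightarrow> j < n \<Longrightarrow> 0 \<le> P $$ (i, j)"
    and r: "spectral_radius (map_mat complex_of_real P) < 1"
  obtains w :: "nat \<Rightarrow> real" and c :: real
  where "\<And>i. i < n \<Longrightarrow> 1 \<le> w i" and "0 \<le> c" and "c < 1"
    and "\<And>i. i < n \<Longrightarrow> (\<Sum>j<n. P $$ (i, j) * w j) \<le> c * w i"
proof -
  define f where "f k = (mat_op P ^^ k) (\<lambda>_. 1)" for k
  have f0: "f 0 i = 1" for i by (simp add: f_def)
  have fS: "f (Suc k) i = (\<Sum>j<n. P $$ (i, j) * f k j)" for k i
    using P by (simp add: f_def mat_op_def)
  have fnn: "0 \<le> f k i" if "i < n" for k i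
    unfolding f_def by (rule mat_op_pow_nonneg[OF P nn _ that]) auto
  have "\<forall>\<^sub>F k in sequentially. \<forall>i\<in>{..<n}. f k i < 1 / 2"
    unfolding eventually_ball_finite_distrib[OF finite_lessThan]
    using mat_op_pow_tendsto_0[OF P n r, of _ "\<lambda>_. 1"] by (auto intro!: order_tendstoD(2)[where y = 0] simp: f_def)
  then obtain m where m: "\<And>i. i < n \<Longrightarrow> f m i < 1 / 2"
    by (auto simp: eventually_sequentially)
  have "m \<noteq> 0" using m[OF n] f0 by (cases m) auto
  define w where "w i = (\<Sum>k<m. f k i)" for i
  have w1: "1 \<le> w i" if "i < n" for i
  proof -
    have "f 0 i \<le> w i" unfolding w_def using \<open>m \<noteq> 0\<close> fnn[OF that] by (intro member_le_sum) auto
    thus ?thesis by (simp add: f0)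
  qed
  define W where "W = Max (w ` {..<n})"
  have W: "w i \<le> W" if "i < n" for i unfolding W_def using that by auto
  have W1: "1 \<le> W" using W[OF n] w1[OF n] by linarith
  have "(\<Sum>j<n. P $$ (i, j) * w j) \<le> (1 - 1 / (2 * W)) * w i" if i: "i < n" for i
  proof -
    have "(\<Sum>j<n. P $$ (i, j) * w j) = (\<Sum>k<m. f (Suc k) i)"
      unfolding w_def fS sum_distrib_left by (rule sum.swap)
    also have "\<dots> = w i - 1 + f m i"
      unfolding w_def using sum.lessThan_Suc_shift[of "\<lambda>k. f k i" m] f0 by simp
    also have "\<dots> \<le> w i - w i / (2 * W)"
    proof -
      have "w i / (2 * W) \<le> 1 / 2" using W[OF i] W1 by (simp add: field_simps)
      thus ?thesis using m[OF i] by linarith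
    qed
    finally show ?thesis by (simp add: algebra_simps)
  qed
  with w1 W1 show thesis by (intro that[of w "1 - 1 / (2 * W)"]) auto
qed

section \<open>Averages against product weights\<close>

lemma abs_weighted_average_le:
  fixes w g :: "'a \<Rightarrow> real"
  assumes "\<And>a. a \<in> A \<Longrightarrow> 0 \<le> w a" and "sum w A = 1"
    and "\<And>a. a \<in> A \<Longrightarrow> \<bar>g a\<bar> \<le> K"
  shows "\<bar>\<Sum>a\<in>A. w a * g a\<bar> \<le> K"
proof -
  have "\<bar>\<Sum>a\<in>A. w a * g a\<bar> \<le> (\<Sum>a\<in>A. w a * \<bar>g a\<bar>)"
    using assms(1) by (intro order_trans[OF sum_abs]) (auto simp: abs_mult intro!: sum_mono)
  also have "\<dots> \<le> (\<Sum>a\<in>A. w a * K)"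
    using assms by (intro sum_mono mult_left_mono) auto
  finally show ?thesis using assms(2) by (simp flip: sum_distrib_right)
qed

text \<open>
  As \<open>d\<close> sums to zero, a constant may be subtracted from \<open>f\<close>. The midpoint of the range of \<open>f\<close>
  leaves values of size at most half the oscillation; this is the source of the factor
  \<open>1 / 2\<close> in the sensitivity matrix.
\<close>

lemma abs_sum_mult_le_half_oscillation:
  fixes f d :: "'a \<Rightarrow> real"
  assumes fin: "finite A" and d: "sum d A = 0"
    and osc: "\<And>a b. a \<in> A \<Longrightarrow> b \<in> A \<Longrightarrow> \<bar>f a - f b\<bar> \<le> L"
  shows "\<bar>\<Sum>a\<in>A. f a * d a\<bar> \<le> L / 2 * (\<Sum>a\<in>A. \<bar>d a\<bar>)"
proof (cases "A = {}")
  case False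
  define m where "m = (Max (f ` A) + Min (f ` A)) / 2"
  have L: "Max (f ` A) - Min (f ` A) \<le> L"
  proof -
    have "Max (f ` A) \<in> f ` A" "Min (f ` A) \<in> f ` A" using fin False by simp_all
    then obtain a b where "a \<in> A" "b \<in> A" "Max (f ` A) = f a" "Min (f ` A) = f b" by blast
    thus ?thesis using osc[of a b] by auto
  qed
  have m: "\<bar>f a - m\<bar> \<le> L / 2" if "a \<in> A" for a
  proof -
    have "Min (f ` A) \<le> f a" "f a \<le> Max (f ` A)" using that fin by auto
    with L have "f a - m \<le> L / 2" "m - f a \<le> L / 2" unfolding m_def by (simp_all add: field_simps)
    thus ?thesis by linarith
  qed
  have "(\<Sum>a\<in>A. f a * d a) = (\<Sum>a\<in>A. (f a - m) * d a)"
    using d by (simp add: left_diff_distrib sum_subtractf flip: sum_distrib_left)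
  also have "\<bar>\<dots>\<bar> \<le> (\<Sum>a\<in>A. L / 2 * \<bar>d a\<bar>)"
    by (intro order_trans[OF sum_abs] sum_mono) (unfold abs_mult, intro mult_right_mono m, auto)
  finally show ?thesis by (simp add: sum_distrib_left)
qed simp

lemma sum_PiE_insert:
  fixes h :: "('i \<Rightarrow> 'a) \<Rightarrow> 'b::comm_monoid_add"
  assumes "i \<notin> I"
  shows "(\<Sum>u\<in>PiE (insert i I) A. h u) = (\<Sum>v\<in>PiE I A. \<Sum>a\<in>A i. h (v(i := a)))"
proof -
  have "(\<Sum>u\<in>PiE (insert i I) A. h u) = (\<Sum>(a, v)\<in>A i \<times> PiE I A. h (v(i := a)))"
    unfolding PiE_insert_eq
    by (subst sum.reindex[OF inj_combinator[OF assms]]) (simp add: case_prod_unfold)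
  also have "\<dots> = (\<Sum>v\<in>PiE I A. \<Sum>a\<in>A i. h (v(i := a)))"
    by (subst sum.swap) (simp add: sum.cartesian_product)
  finally show ?thesis .
qed

lemma prod_fun_upd_insert:
  fixes p :: "'i \<Rightarrow> 'a \<Rightarrow> 'b::comm_monoid_mult"
  assumes "finite I" and "i \<notin> I"
  shows "(\<Prod>k\<in>insert i I. p k ((v(i := a)) k)) = p i a * (\<Prod>k\<in>I. p k (v k))"
  using assms by simp (auto intro!: arg_cong2[where f = "(*)"] prod.cong)

text \<open>
  The coordinates are exchanged one at a time. Replacing \<open>p i\<close> by \<open>q i\<close> in a single coordinate
  pairs \<open>f\<close>, as a function of that coordinate, with a difference of two probability vectors,
  while the other coordinates only average the result.
\<close>

lemma product_weights_diff_le: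
  fixes f :: "('i \<Rightarrow> 'a) \<Rightarrow> real" and p q :: "'i \<Rightarrow> 'a \<Rightarrow> real"
  assumes I: "finite I" and A: "\<And>i. i \<in> I \<Longrightarrow> finite (A i)"
    and p: "\<And>i a. i \<in> I \<Longrightarrow> a \<in> A i \<Longrightarrow> 0 \<le> p i a" "\<And>i. i \<in> I \<Longrightarrow> sum (p i) (A i) = 1"
    and q: "\<And>i a. i \<in> I \<Longrightarrow> a \<in> A i \<Longrightarrow> 0 \<le> q i a" "\<And>i. i \<in> I \<Longrightarrow> sum (q i) (A i) = 1"
    and osc: "\<And>i u b. i \<in> I \<Longrightarrow> u \<in> PiE I A \<Longrightarrow> b \<in> A i \<Longrightarrow> \<bar>f u - f (u(i := b))\<bar> \<le> L i"
  shows "\<bar>(\<Sum>u\<in>PiE I A. f u * (\<Prod>i\<in>I. p i (u i))) - (\<Sum>u\<in>PiE I A. f u * (\<Prod>i\<in>I. q i (u i)))\<bar>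
    \<le> (\<Sum>i\<in>I. L i / 2 * (\<Sum>a\<in>A i. \<bar>p i a - q i a\<bar>))"
  using I A p q osc
proof (induction I arbitrary: f)
  case (insert i I)
  note A = insert.prems(1) and p = insert.prems(2,3) and q = insert.prems(4,5) and osc = insert.prems(6)
  let ?P = "\<lambda>v. \<Prod>k\<in>I. p k (v k)" and ?Q = "\<lambda>v. \<Prod>k\<in>I. q k (v k)"
  let ?D = "\<lambda>v. \<Sum>a\<in>A i. f (v(i := a)) * (p i a - q i a)"
  let ?E = "\<lambda>a. (\<Sum>v\<in>PiE I A. f (v(i := a)) * ?P v) - (\<Sum>v\<in>PiE I A. f (v(i := a)) * ?Q v)"
  have split: "(\<Sum>u\<in>PiE (insert i I) A. f u * (\<Prod>k\<in>insert i I. r k (u k)))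
      = (\<Sum>v\<in>PiE I A. \<Sum>a\<in>A i. f (v(i := a)) * (r i a * (\<Prod>k\<in>I. r k (v k))))" for r :: "'i \<Rightarrow> 'a \<Rightarrow> real"
    unfolding sum_PiE_insert[OF \<open>i \<notin> I\<close>] prod_fun_upd_insert[OF \<open>finite I\<close> \<open>i \<notin> I\<close>] ..
  \<comment> \<open>The average of \<open>?D\<close> under \<open>p\<close> is the effect of exchanging coordinate \<open>i\<close> first, and the
    average of \<open>?E\<close> under \<open>q i\<close> is that of exchanging the other coordinates afterwards.\<close>
  have p_to_q: "(\<Sum>v\<in>PiE I A. \<Sum>a\<in>A i. f (v(i := a)) * (p i a * ?P v))
      - (\<Sum>v\<in>PiE I A. \<Sum>a\<in>A i. f (v(i := a)) * (q i a * ?P v)) = (\<Sum>v\<in>PiE I A. ?P v * ?D v)"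
    unfolding sum_subtractf[symmetric] sum_distrib_left
    by (intro sum.cong refl) (simp add: algebra_simps)
  have swap: "(\<Sum>v\<in>PiE I A. \<Sum>a\<in>A i. f (v(i := a)) * (q i a * R v))
      = (\<Sum>a\<in>A i. q i a * (\<Sum>v\<in>PiE I A. f (v(i := a)) * R v))" for R
    by (subst sum.swap) (simp add: sum_distrib_left mult_ac)
  have E: "(\<Sum>a\<in>A i. q i a * ?E a)
      = (\<Sum>a\<in>A i. q i a * (\<Sum>v\<in>PiE I A. f (v(i := a)) * ?P v))
        - (\<Sum>a\<in>A i. q i a * (\<Sum>v\<in>PiE I A. f (v(i := a)) * ?Q v))"
    by (simp add: right_diff_distrib sum_subtractf)
  have "(\<Sum>u\<in>PiE (insert i I) A. f u * (\<Prod>k\<in>insert i I. p k (u k)))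
      - (\<Sum>u\<in>PiE (insert i I) A. f u * (\<Prod>k\<in>insert i I. q k (u k)))
      = (\<Sum>v\<in>PiE I A. ?P v * ?D v) + (\<Sum>a\<in>A i. q i a * ?E a)"
    unfolding split E p_to_q[symmetric] swap by simp
  moreover have "\<bar>\<Sum>v\<in>PiE I A. ?P v * ?D v\<bar> \<le> L i / 2 * (\<Sum>a\<in>A i. \<bar>p i a - q i a\<bar>)"
  proof (rule abs_weighted_average_le)
    show "0 \<le> ?P v" if "v \<in> PiE I A" for v
      using that p(1) by (intro prod_nonneg) (auto simp: PiE_mem)
    have "(\<Sum>v\<in>PiE I A. ?P v) = (\<Prod>k\<in>I. \<Sum>a\<in>A k. p k a)"
      using insert.hyps A by (simp add: prod_sum_PiE)
    thus "(\<Sum>v\<in>PiE I A. ?P v) = 1" using p(2) by simp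
    show "\<bar>?D v\<bar> \<le> L i / 2 * (\<Sum>a\<in>A i. \<bar>p i a - q i a\<bar>)" if v: "v \<in> PiE I A" for v
    proof (rule abs_sum_mult_le_half_oscillation)
      show "(\<Sum>a\<in>A i. p i a - q i a) = 0" using p(2) q(2) by (simp add: sum_subtractf)
      show "\<bar>f (v(i := a)) - f (v(i := b))\<bar> \<le> L i" if "a \<in> A i" "b \<in> A i" for a b
        using osc[OF insertI1 PiE_fun_upd[where x = i, OF that(1) v] that(2)] unfolding fun_upd_upd .
    qed (use A in auto)
  qed
  moreover have "\<bar>\<Sum>a\<in>A i. q i a * ?E a\<bar> \<le> (\<Sum>k\<in>I. L k / 2 * (\<Sum>a\<in>A k. \<bar>p k a - q k a\<bar>))"
  proof (rule abs_weighted_average_le)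
    fix a assume a: "a \<in> A i"
    show "\<bar>?E a\<bar> \<le> (\<Sum>k\<in>I. L k / 2 * (\<Sum>a\<in>A k. \<bar>p k a - q k a\<bar>))"
    proof (rule insert.IH)
      fix k u b assume k: "k \<in> I" and u: "u \<in> PiE I A" and b: "b \<in> A k"
      have swap: "u(k := b, i := a) = u(i := a, k := b)"
        using k insert.hyps by (intro fun_upd_twist) auto
      show "\<bar>f (u(i := a)) - f (u(k := b, i := a))\<bar> \<le> L k"
        unfolding swap using k by (intro osc PiE_fun_upd a u b) simp
    qed (use A p q in auto)
  qed (use q in auto)
  ultimately show ?case using insert.hyps by simp
qed simp

section \<open>Stability of maximizers under strong convexity\<close>

lemma arg_max_imp_subgradient:
  assumes "is_arg_max (\<lambda>\<delta>. inner F \<delta> - \<Omega> \<delta>) (\<lambda>\<delta>. \<delta> \<in> S) x"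
  shows "F \<in> subdifferential (extend_inf S \<Omega>) x"
proof -
  have "\<Omega> x + inner F (y - x) \<le> \<Omega> y" if "y \<in> S" for y
    using assms that unfolding is_arg_max_def by (force simp: inner_diff_right)
  thus ?thesis using assms unfolding subdifferential_def extend_inf_def is_arg_max_def by auto
qed

lemma l1_norm_minus_commute: "l1_norm (x - y) = l1_norm (y - x)"
  by (simp add: l1_norm_def abs_minus_commute)

lemma l1_norm_nonneg [simp]: "0 \<le> l1_norm x"
  by (simp add: l1_norm_def sum_nonneg)

text \<open>
  Each payoff vector is a subgradient of the regularizer at its own maximizer. Adding the two
  strong convexity inequalities, each evaluated at the other maximizer, cancels the
  regularizer and leaves \<open>\<rho> \<parallel>x - x'\<parallel>\<^sup>2 \<le> \<langle>F - F', x - x'\<rangle>\<close>, which is at most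
  \<open>K \<parallel>x - x'\<parallel>\<close>.
\<close>

lemma l1_strongly_convex_arg_max_stable:
  fixes F F' x x' :: "real ^ 'u::finite"
  assumes sc: "l1_strongly_convex_on \<rho> S \<Omega>" and \<rho>: "0 < \<rho>"
    and x: "is_arg_max (\<lambda>\<delta>. inner F \<delta> - \<Omega> \<delta>) (\<lambda>\<delta>. \<delta> \<in> S) x"
    and x': "is_arg_max (\<lambda>\<delta>. inner F' \<delta> - \<Omega> \<delta>) (\<lambda>\<delta>. \<delta> \<in> S) x'"
    and K: "\<And>a. \<bar>F $ a - F' $ a\<bar> \<le> K"
  shows "l1_norm (x - x') \<le> K / \<rho>"
proof -
  let ?n = "l1_norm (x - x')"
  have S: "x \<in> S" "x' \<in> S" using x x' by (auto simp: is_arg_max_def)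
  have "\<Omega> x + inner F (x' - x) + \<rho> / 2 * ?n\<^sup>2 \<le> \<Omega> x'"
    using sc S arg_max_imp_subgradient[OF x] unfolding l1_strongly_convex_on_def
    by (metis l1_norm_minus_commute)
  moreover have "\<Omega> x' + inner F' (x - x') + \<rho> / 2 * ?n\<^sup>2 \<le> \<Omega> x"
    using sc S arg_max_imp_subgradient[OF x'] unfolding l1_strongly_convex_on_def by metis
  ultimately have "\<rho> * ?n\<^sup>2 \<le> inner (F - F') (x - x')"
    by (simp add: inner_diff_left inner_diff_right field_simps)
  also have "\<dots> \<le> (\<Sum>a\<in>UNIV. K * \<bar>(x - x') $ a\<bar>)"
    unfolding inner_vec_def
  proof (rule sum_mono)
    fix a
    have "inner ((F - F') $ a) ((x - x') $ a) \<le> \<bar>F $ a - F' $ a\<bar> * \<bar>(x - x') $ a\<bar>"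
      by (metis abs_ge_self abs_mult inner_real_def vector_minus_component)
    also have "\<dots> \<le> K * \<bar>(x - x') $ a\<bar>" using K by (intro mult_right_mono) auto
    finally show "inner ((F - F') $ a) ((x - x') $ a) \<le> K * \<bar>(x - x') $ a\<bar>" .
  qed
  also have "\<dots> = K * ?n" by (simp add: l1_norm_def sum_distrib_left)
  finally have *: "\<rho> * ?n * ?n \<le> K * ?n" by (simp add: power2_eq_square mult.assoc)
  have "0 \<le> K" using K[of undefined] by linarith
  show ?thesis
  proof (cases "?n = 0")
    case False
    hence "0 < ?n" using l1_norm_nonneg[of "x - x'"] by linarith
    with * have "\<rho> * ?n \<le> K" by simp
    thus ?thesis using \<rho> by (simp add: field_simps)
  qed (use \<open>0 \<le> K\<close> \<rho> in simp)
qed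

section \<open>Sensitivity of best responses\<close>

definition action_value ::
  "('x, 'y, 'u::finite) team \<Rightarrow> nat \<Rightarrow> (nat \<Rightarrow> 'y \<Rightarrow> real ^ 'u) \<Rightarrow> 'y \<Rightarrow> 'u \<Rightarrow> real" where
  "action_value T j g b a =
     (\<Sum>y\<in>PiE (others T j) (observations T). (\<Prod>i\<in>others T j. pmf (obs_dist T i) (y i)) *
        (\<Sum>v\<in>PiE (others T j) (actions T).
           avg_reward T (y(j := b)) (v(j := a)) * (\<Prod>i\<in>others T j. g i (y i) $ v i)))"

text \<open>
  The zero entries off \<open>actions T j\<close> do not affect the inner product with a mixed action, and
  with them a bound on the differences of action values holds at every coordinate.
\<close>

definition payoff_vector ::
  "('x, 'y, 'u::finite) team \<Rightarrow> nat \<Rightarrow> (nat \<Rightarrow> 'y \<Rightarrow> real ^ 'u) \<Rightarrow> 'y \<Rightarrow> real ^ 'u" where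
  "payoff_vector T j g b = (\<chi> a. if a \<in> actions T j then action_value T j g b a else 0)"

lemma finite_others [simp]: "finite (others T j)"
  and not_in_others [simp]: "j \<notin> others T j"
  and insert_others: "j \<in> agents T \<Longrightarrow> insert j (others T j) = agents T"
  and others_agents: "i \<in> others T j \<Longrightarrow> i \<in> agents T"
  by (auto simp: others_def agents_def)

lemma inner_payoff_vector:
  assumes "\<delta> \<in> mixed_actions T j"
  shows "inner (payoff_vector T j g b) \<delta> = (\<Sum>a\<in>actions T j. \<delta> $ a * action_value T j g b a)"
proof -
  have "inner (payoff_vector T j g b) \<delta>
      = (\<Sum>a\<in>UNIV. if a \<in> actions T j then \<delta> $ a * action_value T j g b a else 0)"
    unfolding payoff_vector_def inner_vec_def by (intro sum.cong) auto
  thus ?thesis by (simp add: sum.If_cases)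
qed

text \<open>
  The expected reward is multilinear in the mixed actions, so Agent \<open>j\<close> faces a linear payoff
  minus a strongly convex penalty.
\<close>

lemma response_objective_linear:
  assumes j: "j \<in> agents T" and \<delta>: "\<delta> \<in> mixed_actions T j"
  shows "response_objective T j g b \<delta> = inner (payoff_vector T j g b) \<delta> - regularizer T j \<delta>"
proof -
  have mixed: "mixed_reward T (y(j := b)) ((\<lambda>i\<in>others T j. g i (y i))(j := \<delta>))
      = (\<Sum>a\<in>actions T j. \<delta> $ a * (\<Sum>v\<in>PiE (others T j) (actions T).
           avg_reward T (y(j := b)) (v(j := a)) * (\<Prod>i\<in>others T j. g i (y i) $ v i)))" for y
  proof -
    let ?\<delta> = "(\<lambda>i\<in>others T j. g i (y i))(j := \<delta>)"
    have prod_eq: "(\<Prod>i\<in>insert j (others T j). ?\<delta> i $ (v(j := a)) i) = \<delta> $ a * (\<Prod>i\<in>others T j. g i (y i) $ v i)"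
      for v a
      by (subst prod_fun_upd_insert[where p = "\<lambda>i x. ?\<delta> i $ x"])
        (auto intro!: arg_cong2[where f = "(*)"] prod.cong)
    have "mixed_reward T (y(j := b)) ?\<delta> = (\<Sum>v\<in>PiE (others T j) (actions T). \<Sum>a\<in>actions T j.
        avg_reward T (y(j := b)) (v(j := a)) * (\<delta> $ a * (\<Prod>i\<in>others T j. g i (y i) $ v i)))"
      unfolding mixed_reward_def action_profiles_def insert_others[OF j, symmetric]
      by (simp only: sum_PiE_insert[OF not_in_others] prod_eq)
    also have "\<dots> = (\<Sum>a\<in>actions T j. \<delta> $ a * (\<Sum>v\<in>PiE (others T j) (actions T).
           avg_reward T (y(j := b)) (v(j := a)) * (\<Prod>i\<in>others T j. g i (y i) $ v i)))"
      by (subst sum.swap) (simp add: sum_distrib_left mult_ac)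
    finally show ?thesis .
  qed
  show ?thesis
    unfolding response_objective_def mixed inner_payoff_vector[OF \<delta>] action_value_def sum_distrib_left sum_distrib_right
    by (subst sum.swap) (simp add: mult_ac)
qed

lemma is_arg_max_response_objective:
  assumes "j \<in> agents T"
  shows "is_arg_max (response_objective T j g b) (\<lambda>\<delta>. \<delta> \<in> mixed_actions T j) x \<longleftrightarrow>
    is_arg_max (\<lambda>\<delta>. inner (payoff_vector T j g b) \<delta> - regularizer T j \<delta>) (\<lambda>\<delta>. \<delta> \<in> mixed_actions T j) x"
  using response_objective_linear[OF assms] unfolding is_arg_max_def by auto

lemma best_response_is_arg_max:
  assumes "unique_best_responses T" and "j \<in> agents T"
    and "g \<in> PiE (others T j) (policies T)" and "b \<in> observations T j"
  shows "is_arg_max (response_objective T j g b) (\<lambda>\<delta>. \<delta> \<in> mixed_actions T j) (best_response T j g b)"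
proof -
  have "\<exists>\<delta>. is_arg_max (response_objective T j g b) (\<lambda>\<delta>. \<delta> \<in> mixed_actions T j) \<delta>"
    using assms unfolding unique_best_responses_def by blast
  thus ?thesis using assms(4) unfolding best_response_def arg_max_def by (simp add: someI_ex)
qed

lemma best_response_in_policies:
  assumes "unique_best_responses T" and "j \<in> agents T" and "g \<in> PiE (others T j) (policies T)"
  shows "best_response T j g \<in> policies T j"
  using best_response_is_arg_max[OF assms]
  unfolding policies_def is_arg_max_def by (auto simp: best_response_def)

lemma team_model_finite:
  assumes "team_model T" and "i \<in> agents T"
  shows "finite (actions T i)" "actions T i \<noteq> {}" "finite (observations T i)" "observations T i \<noteq> {}"
  using assms unfolding team_model_def by auto

lemma finite_agents [simp]: "finite (agents T)"
  by (simp add: agents_def)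

lemma avg_reward_oscillation:
  assumes tm: "team_model T" and i: "i \<in> agents T" and y: "y \<in> obs_profiles T"
    and u: "u \<in> action_profiles T" and b: "b \<in> actions T i"
  shows "\<bar>avg_reward T y u - avg_reward T y (u(i := b))\<bar> \<le> reward_oscillation T i"
proof -
  let ?r = "\<lambda>y v a. avg_reward T y (v(i := a))"
  let ?osc = "\<lambda>(y, v). (SUP a\<in>actions T i. ?r y v a) - (INF a\<in>actions T i. ?r y v a)"
  let ?D = "obs_profiles T \<times> PiE (others T i) (actions T)"
  \<comment> \<open>The oscillation is a supremum over profiles without Agent \<open>i\<close>; extensionality forces
    the value \<open>undefined\<close> at the removed index.\<close>
  define v where "v = u(i := undefined)"
  have v: "v \<in> PiE (others T i) (actions T)"
    using u fun_upd_in_PiE[of i "others T i" u "actions T"]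
    unfolding v_def action_profiles_def insert_others[OF i, symmetric] by simp
  have ui: "u i \<in> actions T i" using u i unfolding action_profiles_def by auto
  have fin: "finite (?r y v ` actions T i)" using team_model_finite[OF tm i] by simp
  have bd: "(INF a\<in>actions T i. ?r y v a) \<le> ?r y v a" "?r y v a \<le> (SUP a\<in>actions T i. ?r y v a)"
    if "a \<in> actions T i" for a
    using that fin by (auto intro!: cINF_lower cSUP_upper simp: bdd_below_finite bdd_above_finite)
  have "\<bar>?r y v (u i) - ?r y v b\<bar> \<le> ?osc (y, v)"
    using bd[OF ui] bd[OF b] by auto
  also have "\<dots> \<le> (SUP z\<in>?D. ?osc z)"
  proof (rule cSUP_upper)
    have "finite ?D" using team_model_finite[OF tm] team_model_finite[OF tm others_agents]
      by (auto simp: obs_profiles_def intro!: finite_PiE)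
    thus "bdd_above (?osc ` ?D)" by (intro bdd_above_finite finite_imageI)
  qed (use y v in auto)
  finally show ?thesis by (simp add: v_def reward_oscillation_def)
qed

lemma reward_oscillation_nonneg:
  assumes "team_model T" and "i \<in> agents T"
  shows "0 \<le> reward_oscillation T i"
proof -
  have "\<exists>y. y \<in> obs_profiles T" "\<exists>u. u \<in> action_profiles T"
    using team_model_finite[OF assms(1)] by (auto simp: obs_profiles_def action_profiles_def ex_in_conv PiE_eq_empty_iff)
  then obtain y u where "y \<in> obs_profiles T" and u: "u \<in> action_profiles T" by blast
  moreover have "u i \<in> actions T i" using u assms(2) unfolding action_profiles_def by auto
  ultimately show ?thesis using avg_reward_oscillation[OF assms, of y u "u i"] by simp
qed

lemma policies_mixed_action:
  assumes "p \<in> policies T i" and "b \<in> observations T i"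
  shows "p b \<in> mixed_actions T i"
  using assms unfolding policies_def by auto

lemma l1_norm_mixed_diff:
  assumes "\<delta> \<in> mixed_actions T i" and "\<delta>' \<in> mixed_actions T i"
  shows "l1_norm (\<delta> - \<delta>') = (\<Sum>a\<in>actions T i. \<bar>\<delta> $ a - \<delta>' $ a\<bar>)"
  using assms unfolding l1_norm_def mixed_actions_def by (intro sum.mono_neutral_cong_right) auto

text \<open>
  For each fixed observation profile the others act independently, so changing their policies
  exchanges product weights on their actions. Averaging over observation profiles preserves
  the bound.
\<close>

lemma action_value_diff_le:
  assumes tm: "team_model T" and j: "j \<in> agents T"
    and g: "g \<in> PiE (others T j) (policies T)" and g': "g' \<in> PiE (others T j) (policies T)"
    and b: "b \<in> observations T j" and a: "a \<in> actions T j"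
    and d: "\<And>i c. i \<in> others T j \<Longrightarrow> c \<in> observations T i \<Longrightarrow> l1_norm (g i c - g' i c) \<le> d i"
  shows "\<bar>action_value T j g b a - action_value T j g' b a\<bar> \<le> (\<Sum>i\<in>others T j. reward_oscillation T i / 2 * d i)"
proof -
  let ?O = "others T j"
  let ?w = "\<lambda>y. \<Prod>i\<in>?O. pmf (obs_dist T i) (y i)"
  let ?V = "\<lambda>g y. \<Sum>v\<in>PiE ?O (actions T). avg_reward T (y(j := b)) (v(j := a)) * (\<Prod>i\<in>?O. g i (y i) $ v i)"
  have "action_value T j g b a - action_value T j g' b a
      = (\<Sum>y\<in>PiE ?O (observations T). ?w y * (?V g y - ?V g' y))"
    unfolding action_value_def by (simp add: sum_subtractf right_diff_distrib)
  also have "\<bar>\<dots>\<bar> \<le> (\<Sum>i\<in>?O. reward_oscillation T i / 2 * d i)"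
  proof (rule abs_weighted_average_le)
    show "0 \<le> ?w y" for y by (intro prod_nonneg) simp
    have "sum ?w (PiE ?O (observations T)) = (\<Prod>i\<in>?O. \<Sum>c\<in>observations T i. pmf (obs_dist T i) c)"
      using team_model_finite[OF tm others_agents] by (intro prod_sum_PiE[symmetric]) auto
    also have "\<dots> = 1"
      using team_model_finite[OF tm others_agents]
      by (intro prod.neutral ballI sum_pmf_eq_1) (simp_all add: obs_dist_def)
    finally show "sum ?w (PiE ?O (observations T)) = 1" .
  next
    fix y assume y: "y \<in> PiE ?O (observations T)"
    have mem: "g i (y i) \<in> mixed_actions T i" "g' i (y i) \<in> mixed_actions T i" if "i \<in> ?O" for i
      using that y g g' by (auto intro!: policies_mixed_action simp: PiE_mem)
    have "\<bar>?V g y - ?V g' y\<bar>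
        \<le> (\<Sum>i\<in>?O. reward_oscillation T i / 2 * (\<Sum>a\<in>actions T i. \<bar>g i (y i) $ a - g' i (y i) $ a\<bar>))"
    proof (rule product_weights_diff_le)
      fix i u c assume i: "i \<in> ?O" and u: "u \<in> PiE ?O (actions T)" and c: "c \<in> actions T i"
      have "y(j := b) \<in> obs_profiles T" "u(j := a) \<in> action_profiles T"
        unfolding obs_profiles_def action_profiles_def insert_others[OF j, symmetric]
        using y b u a by (auto intro!: PiE_fun_upd)
      note osc = avg_reward_oscillation[OF tm others_agents[OF i] this c]
      have swap: "u(i := c, j := a) = u(j := a, i := c)" using i by (intro fun_upd_twist) auto
      show "\<bar>avg_reward T (y(j := b)) (u(j := a)) - avg_reward T (y(j := b)) (u(i := c, j := a))\<bar>
          \<le> reward_oscillation T i"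
        unfolding swap by (rule osc)
    qed (use mem team_model_finite[OF tm others_agents] in \<open>auto simp: mixed_actions_def\<close>)
    also have "\<dots> \<le> (\<Sum>i\<in>?O. reward_oscillation T i / 2 * d i)"
    proof (intro sum_mono mult_left_mono)
      fix i assume i: "i \<in> ?O"
      show "(\<Sum>a\<in>actions T i. \<bar>g i (y i) $ a - g' i (y i) $ a\<bar>) \<le> d i"
        using d[OF i, of "y i"] y i l1_norm_mixed_diff[OF mem[OF i]] by (auto simp: PiE_mem)
      show "0 \<le> reward_oscillation T i / 2"
        using reward_oscillation_nonneg[OF tm others_agents[OF i]] by simp
    qed
    finally show "\<bar>?V g y - ?V g' y\<bar> \<le> (\<Sum>i\<in>?O. reward_oscillation T i / 2 * d i)" .
  qed
  finally show ?thesis .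
qed

text \<open>
  The deviations \<open>d\<close> are uniform over observations instead of averages as in \<^term>\<open>policy_norm\<close>,
  which they dominate. This way the conclusion has the same form as the hypothesis
  and the estimate can be iterated.
\<close>

lemma best_response_lipschitz:
  assumes tm: "team_model T" and reg: "regularized T" and ub: "unique_best_responses T"
    and j: "j \<in> agents T"
    and g: "g \<in> PiE (others T j) (policies T)" and g': "g' \<in> PiE (others T j) (policies T)"
    and b: "b \<in> observations T j"
    and d: "\<And>i c. i \<in> others T j \<Longrightarrow> c \<in> observations T i \<Longrightarrow> l1_norm (g i c - g' i c) \<le> d i"
  shows "l1_norm (best_response T j g b - best_response T j g' b)
    \<le> (\<Sum>i\<in>others T j. sensitivity_matrix T $$ (j, i) * d i)"
proof -
  let ?K = "\<Sum>i\<in>others T j. reward_oscillation T i / 2 * d i"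
  have \<rho>: "0 < reg_modulus T j"
    and sc: "l1_strongly_convex_on (reg_modulus T j) (mixed_actions T j) (regularizer T j)"
    using reg j unfolding regularized_def by auto
  have "0 \<le> d i" if "i \<in> others T j" for i
    using team_model_finite(4)[OF tm others_agents[OF that]] d[OF that]
    by (metis all_not_in_conv l1_norm_nonneg order_trans)
  hence "0 \<le> ?K" using reward_oscillation_nonneg[OF tm others_agents]
    by (intro sum_nonneg mult_nonneg_nonneg) simp_all
  hence "l1_norm (best_response T j g b - best_response T j g' b) \<le> ?K / reg_modulus T j"
    using action_value_diff_le[OF tm j g g' b _ d]
    by (intro l1_strongly_convex_arg_max_stable[OF sc \<rho>
          best_response_is_arg_max[OF ub j g b, unfolded is_arg_max_response_objective[OF j]]
          best_response_is_arg_max[OF ub j g' b, unfolded is_arg_max_response_objective[OF j]]])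
      (auto simp: payoff_vector_def)
  also have "\<dots> = (\<Sum>i\<in>others T j. sensitivity_matrix T $$ (j, i) * d i)"
    unfolding sum_divide_distrib using j
    by (intro sum.cong) (auto simp: sensitivity_matrix_def others_def agents_def)
  finally show ?thesis .
qed

section \<open>The fixed point of the best response operator\<close>

lemma norm_le_l1_norm: "norm v \<le> l1_norm v"
  unfolding l1_norm_def by (rule norm_le_l1_cart)

lemma l1_norm_le_0D: "l1_norm v \<le> 0 \<Longrightarrow> v = 0"
  using norm_le_l1_norm[of v] by (simp flip: norm_le_zero_iff)

lemma tendsto_iff_l1_norm:
  fixes x :: "nat \<Rightarrow> real ^ 'u::finite"
  shows "x \<longlonglongrightarrow> a \<longleftrightarrow> (\<lambda>k. l1_norm (x k - a)) \<longlonglongrightarrow> 0"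
proof
  assume "x \<longlonglongrightarrow> a"
  hence "(\<lambda>k. \<Sum>i\<in>UNIV. \<bar>(x k - a) $ i\<bar>) \<longlonglongrightarrow> (\<Sum>i\<in>(UNIV::'u set). \<bar>(a - a) $ i\<bar>)"
    by (intro tendsto_intros)
  thus "(\<lambda>k. l1_norm (x k - a)) \<longlonglongrightarrow> 0" by (simp add: l1_norm_def)
next
  assume "(\<lambda>k. l1_norm (x k - a)) \<longlonglongrightarrow> 0"
  hence "(\<lambda>k. x k - a) \<longlonglongrightarrow> 0"
    by (rule Lim_null_comparison[rotated]) (simp add: norm_le_l1_norm)
  thus "x \<longlonglongrightarrow> a" by (simp add: LIM_zero_iff)
qed

lemma closed_mixed_actions: "closed (mixed_actions T i)"
proof -
  have "mixed_actions T i = (\<Inter>a. {\<delta>. 0 \<le> \<delta> $ a}) \<inter> (\<Inter>a\<in>- actions T i. {\<delta>. \<delta> $ a = 0})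
      \<inter> {\<delta>. (\<Sum>a\<in>actions T i. \<delta> $ a) = 1}"
    unfolding mixed_actions_def by blast
  also have "closed \<dots>"
    by (intro closed_Int closed_INT ballI closed_Collect_le closed_Collect_eq continuous_intros)
  finally show ?thesis .
qed

lemma l1_norm_mixed_diff_le_2:
  assumes "\<delta> \<in> mixed_actions T i" and "\<delta>' \<in> mixed_actions T i"
  shows "l1_norm (\<delta> - \<delta>') \<le> 2"
proof -
  have "l1_norm (\<delta> - \<delta>') \<le> (\<Sum>a\<in>actions T i. \<delta> $ a + \<delta>' $ a)"
    unfolding l1_norm_mixed_diff[OF assms]
  proof (rule sum_mono)
    fix a
    have "0 \<le> \<delta> $ a" "0 \<le> \<delta>' $ a" using assms unfolding mixed_actions_def by blast+
    thus "\<bar>\<delta> $ a - \<delta>' $ a\<bar> \<le> \<delta> $ a + \<delta>' $ a" by linarith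
  qed
  thus ?thesis using assms by (simp add: sum.distrib mixed_actions_def)
qed

lemma restrict_others_policies:
  assumes "\<gamma> \<in> policy_profiles T"
  shows "restrict \<gamma> (others T j) \<in> PiE (others T j) (policies T)"
  using assms others_agents unfolding policy_profiles_def by (auto simp: PiE_mem)

lemma policy_profiles_mixed_action:
  assumes "\<gamma> \<in> policy_profiles T" and "i \<in> agents T" and "b \<in> observations T i"
  shows "\<gamma> i b \<in> mixed_actions T i"
  using assms unfolding policy_profiles_def by (auto intro!: policies_mixed_action simp: PiE_mem)

lemma policy_profiles_eqI:
  assumes "\<gamma> \<in> policy_profiles T" and "\<gamma>' \<in> policy_profiles T"
    and "\<And>i b. i \<in> agents T \<Longrightarrow> b \<in> observations T i \<Longrightarrow> \<gamma> i b = \<gamma>' i b"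
  shows "\<gamma> = \<gamma>'"
proof (rule PiE_ext[OF assms(1,2)[unfolded policy_profiles_def]])
  fix i assume i: "i \<in> agents T"
  hence "\<gamma> i \<in> policies T i" "\<gamma>' i \<in> policies T i"
    using assms(1,2) unfolding policy_profiles_def by (blast intro: PiE_mem)+
  thus "\<gamma> i = \<gamma>' i" unfolding policies_def by (rule PiE_ext) (rule assms(3)[OF i])
qed

text \<open>
  With weights as in \<open>spectral_radius_less_1_weights\<close> the best response operator contracts the weighted maximum norm by
  the factor \<open>c\<close>. Weights of at least one let the initial distance, which is at most 2 for any
  two mixed actions, be measured on the same scale.
\<close>

locale weighted_team =
  fixes T :: "('x::polish_space, 'y, 'u::finite) team" and w :: "nat \<Rightarrow> real" and c :: real
  assumes model: "team_model T" and reg: "regularized T" and unique: "unique_best_responses T"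
    and weight_ge_1: "\<And>i. i \<in> agents T \<Longrightarrow> 1 \<le> w i"
    and rate: "0 \<le> c" "c < 1"
    and contraction: "\<And>j. j \<in> agents T \<Longrightarrow> (\<Sum>i\<in>agents T. sensitivity_matrix T $$ (j, i) * w i) \<le> c * w j"
begin

abbreviation "B \<equiv> best_response_operator T"

definition policy_close :: "real \<Rightarrow> nat \<Rightarrow> ('y \<Rightarrow> real ^ 'u) \<Rightarrow> ('y \<Rightarrow> real ^ 'u) \<Rightarrow> bool" where
  "policy_close M i p p' \<longleftrightarrow> (\<forall>b\<in>observations T i. l1_norm (p b - p' b) \<le> M * w i)"

lemma best_response_close:
  assumes j: "j \<in> agents T" and M: "0 \<le> M"
    and g: "\<gamma> \<in> policy_profiles T" "\<gamma>' \<in> policy_profiles T"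
    and close: "\<And>i. i \<in> others T j \<Longrightarrow> policy_close M i (\<gamma> i) (\<gamma>' i)"
  shows "policy_close (c * M) j (best_response T j (restrict \<gamma> (others T j)))
    (best_response T j (restrict \<gamma>' (others T j)))"
  unfolding policy_close_def
proof
  fix b assume b: "b \<in> observations T j"
  let ?g = "restrict \<gamma> (others T j)" and ?g' = "restrict \<gamma>' (others T j)"
  have "l1_norm (best_response T j ?g b - best_response T j ?g' b)
      \<le> (\<Sum>i\<in>others T j. sensitivity_matrix T $$ (j, i) * (M * w i))"
    using close g unfolding policy_close_def
    by (intro best_response_lipschitz[OF model reg unique j _ _ b] restrict_others_policies) auto
  also have "\<dots> = M * (\<Sum>i\<in>insert j (others T j). sensitivity_matrix T $$ (j, i) * w i)"
    using j by (simp add: sum_distrib_left mult_ac sensitivity_matrix_def agents_def)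
  also have "\<dots> \<le> M * (c * w j)"
    using contraction[OF j] M unfolding insert_others[OF j] by (rule mult_left_mono)
  finally show "l1_norm (best_response T j ?g b - best_response T j ?g' b) \<le> c * M * w j"
    by (simp add: mult_ac)
qed

lemma B_apply: "j \<in> agents T \<Longrightarrow> B \<gamma> j = best_response T j (restrict \<gamma> (others T j))"
  by (simp add: best_response_operator_def)

lemma B_policy_profiles:
  assumes "\<gamma> \<in> policy_profiles T"
  shows "B \<gamma> \<in> policy_profiles T"
  unfolding policy_profiles_def
proof (intro PiE_I)
  show "B \<gamma> j \<in> policies T j" if "j \<in> agents T" for j
    unfolding B_apply[OF that]
    by (intro best_response_in_policies unique that restrict_others_policies assms)
qed (simp add: best_response_operator_def)

lemma B_pow_policy_profiles: "\<gamma> \<in> policy_profiles T \<Longrightarrow> (B ^^ k) \<gamma> \<in> policy_profiles T"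
  by (induction k) (auto intro: B_policy_profiles)

lemma policy_close_2:
  assumes "\<gamma> \<in> policy_profiles T" "\<gamma>' \<in> policy_profiles T" "i \<in> agents T"
  shows "policy_close 2 i (\<gamma> i) (\<gamma>' i)"
  unfolding policy_close_def
proof
  fix b assume b: "b \<in> observations T i"
  have "l1_norm (\<gamma> i b - \<gamma>' i b) \<le> 2"
    by (rule l1_norm_mixed_diff_le_2[OF policy_profiles_mixed_action[OF assms(1,3) b]
          policy_profiles_mixed_action[OF assms(2,3) b]])
  also have "\<dots> \<le> 2 * w i" using weight_ge_1[OF assms(3)] by simp
  finally show "l1_norm (\<gamma> i b - \<gamma>' i b) \<le> 2 * w i" .
qed

lemma B_pow_close:
  assumes g: "\<gamma> \<in> policy_profiles T" "\<gamma>' \<in> policy_profiles T" and i: "i \<in> agents T"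
  shows "policy_close (2 * c ^ k) i ((B ^^ k) \<gamma> i) ((B ^^ k) \<gamma>' i)"
  using i
proof (induction k arbitrary: i)
  case 0
  thus ?case using policy_close_2[OF g] by simp
next
  case (Suc k)
  have "policy_close (c * (2 * c ^ k)) i (best_response T i (restrict ((B ^^ k) \<gamma>) (others T i)))
      (best_response T i (restrict ((B ^^ k) \<gamma>') (others T i)))"
    using rate by (intro best_response_close Suc B_pow_policy_profiles g others_agents) auto
  thus ?case by (simp add: B_apply[OF Suc.prems] mult_ac)
qed

text \<open>
  Continuity of the operator under pointwise convergence. The sum over the finitely many
  observations turns pointwise convergence into the uniform deviations required by the
  Lipschitz estimate.
\<close>

lemma B_tendsto:
  assumes x: "\<And>k. x k \<in> policy_profiles T" and \<gamma>: "\<gamma> \<in> policy_profiles T"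
    and lim: "\<And>i b. i \<in> agents T \<Longrightarrow> b \<in> observations T i \<Longrightarrow> (\<lambda>k. x k i b) \<longlonglongrightarrow> \<gamma> i b"
    and j: "j \<in> agents T" and b: "b \<in> observations T j"
  shows "(\<lambda>k. B (x k) j b) \<longlonglongrightarrow> B \<gamma> j b"
proof -
  define d where "d k i = (\<Sum>b\<in>observations T i. l1_norm (x k i b - \<gamma> i b))" for k i
  have le: "l1_norm (B (x k) j b - B \<gamma> j b) \<le> (\<Sum>i\<in>others T j. sensitivity_matrix T $$ (j, i) * d k i)" for k
  proof -
    have "l1_norm (x k i b - \<gamma> i b) \<le> d k i" if "i \<in> others T j" "b \<in> observations T i" for i b
      unfolding d_def using that team_model_finite(3)[OF model others_agents[OF that(1)]]
      by (intro member_le_sum) auto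
    hence "l1_norm (best_response T j (restrict (x k) (others T j)) b
          - best_response T j (restrict \<gamma> (others T j)) b)
        \<le> (\<Sum>i\<in>others T j. sensitivity_matrix T $$ (j, i) * d k i)"
      by (intro best_response_lipschitz[OF model reg unique j _ _ b] restrict_others_policies x \<gamma>) auto
    thus ?thesis by (simp add: B_apply[OF j])
  qed
  have "(\<lambda>k. d k i) \<longlonglongrightarrow> 0" if "i \<in> others T j" for i
    unfolding d_def using lim[OF others_agents[OF that]]
    by (intro tendsto_null_sum) (simp flip: tendsto_iff_l1_norm)
  hence "(\<lambda>k. \<Sum>i\<in>others T j. sensitivity_matrix T $$ (j, i) * d k i) \<longlonglongrightarrow> 0"
    by (intro tendsto_null_sum tendsto_mult_right_zero)
  hence "(\<lambda>k. l1_norm (B (x k) j b - B \<gamma> j b)) \<longlonglongrightarrow> 0"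
    by (rule Lim_null_comparison[rotated]) (use le in simp)
  thus ?thesis by (simp add: tendsto_iff_l1_norm)
qed

text \<open>
  The iterates move by at most a multiple of \<open>c ^ k\<close> at step \<open>k\<close>, so they converge at every
  observation; the limit is again a policy profile because the simplices are closed, and it is
  fixed by continuity.
\<close>

lemma ex_fixed_point:
  assumes \<gamma>0: "\<gamma>0 \<in> policy_profiles T"
  shows "\<exists>\<gamma>\<in>policy_profiles T. B \<gamma> = \<gamma>"
proof -
  define x where "x k = (B ^^ k) \<gamma>0" for k
  have x: "x k \<in> policy_profiles T" for k
    unfolding x_def by (rule B_pow_policy_profiles[OF \<gamma>0])
  have conv: "convergent (\<lambda>k. x k i b)" if i: "i \<in> agents T" and b: "b \<in> observations T i" for i b
  proof -
    have step: "norm (x (Suc k) i b - x k i b) \<le> 2 * w i * c ^ k" for k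
    proof -
      have "policy_close (2 * c ^ k) i (x (Suc k) i) (x k i)"
        unfolding x_def funpow_Suc_right comp_def
        by (intro B_pow_close B_policy_profiles \<gamma>0 i)
      hence "l1_norm (x (Suc k) i b - x k i b) \<le> 2 * c ^ k * w i"
        using b unfolding policy_close_def by blast
      thus ?thesis using norm_le_l1_norm[of "x (Suc k) i b - x k i b"] by (simp add: mult_ac)
    qed
    have "summable (\<lambda>k. x (Suc k) i b - x k i b)"
    proof (rule summable_comparison_test'[where N = 0])
      show "summable (\<lambda>k. 2 * w i * c ^ k)" using rate by (intro summable_mult summable_geometric) auto
    qed (rule step)
    hence "convergent (\<lambda>n. \<Sum>k<n. x (Suc k) i b - x k i b)" by (simp add: summable_iff_convergent)
    hence "convergent (\<lambda>n. (x n i b - x 0 i b) + x 0 i b)"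
      unfolding sum_lessThan_telescope[of "\<lambda>k. x k i b"] by (intro convergent_add convergent_const)
    thus ?thesis by simp
  qed
  define \<gamma> where "\<gamma> = (\<lambda>i\<in>agents T. \<lambda>b\<in>observations T i. lim (\<lambda>k. x k i b))"
  have lim: "(\<lambda>k. x k i b) \<longlonglongrightarrow> \<gamma> i b" if "i \<in> agents T" "b \<in> observations T i" for i b
    using conv[OF that] that by (simp add: \<gamma>_def convergent_LIMSEQ_iff)
  have \<gamma>: "\<gamma> \<in> policy_profiles T"
    unfolding policy_profiles_def policies_def
  proof (intro PiE_I)
    fix i b assume i: "i \<in> agents T" and b: "b \<in> observations T i"
    show "\<gamma> i b \<in> mixed_actions T i"
      using closed_sequentially[OF closed_mixed_actions _ lim[OF i b]] policy_profiles_mixed_action[OF x i b]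
      by blast
  qed (auto simp: \<gamma>_def)
  have "B \<gamma> j b = \<gamma> j b" if j: "j \<in> agents T" and b: "b \<in> observations T j" for j b
  proof (rule LIMSEQ_unique)
    show "(\<lambda>k. B (x k) j b) \<longlonglongrightarrow> B \<gamma> j b" by (rule B_tendsto[OF x \<gamma> lim j b])
    have "B (x k) = x (Suc k)" for k by (simp add: x_def)
    thus "(\<lambda>k. B (x k) j b) \<longlonglongrightarrow> \<gamma> j b" using LIMSEQ_Suc[OF lim[OF j b]] by simp
  qed
  hence "B \<gamma> = \<gamma>" by (rule policy_profiles_eqI[OF B_policy_profiles[OF \<gamma>] \<gamma>])
  with \<gamma> show ?thesis by blast
qed

lemma fixed_point_unique:
  assumes g: "\<gamma> \<in> policy_profiles T" "\<gamma>' \<in> policy_profiles T" and fixed: "B \<gamma> = \<gamma>" "B \<gamma>' = \<gamma>'"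
  shows "\<gamma> = \<gamma>'"
proof -
  have pow: "(B ^^ k) \<gamma> = \<gamma>" "(B ^^ k) \<gamma>' = \<gamma>'" for k
    using fixed by (induction k) auto
  have "\<gamma> i b = \<gamma>' i b" if i: "i \<in> agents T" and b: "b \<in> observations T i" for i b
  proof -
    have "l1_norm (\<gamma> i b - \<gamma>' i b) \<le> 2 * c ^ k * w i" for k
      using B_pow_close[OF g i, of k] b unfolding pow policy_close_def by blast
    moreover have "(\<lambda>k. 2 * c ^ k * w i) \<longlonglongrightarrow> 0"
      using rate by (intro tendsto_mult_left_zero tendsto_mult_right_zero LIMSEQ_power_zero) auto
    ultimately have "l1_norm (\<gamma> i b - \<gamma>' i b) \<le> 0" by (intro LIMSEQ_le_const) auto
    from l1_norm_le_0D[OF this] show ?thesis by simp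
  qed
  thus ?thesis by (rule policy_profiles_eqI[OF g])
qed

end

section \<open>Convergence of the asynchronous iteration\<close>

lemma eventually_sequentially_persistent:
  assumes "t0 \<le> \<tau>" and "P \<tau>" and "\<And>t. t0 \<le> t \<Longrightarrow> P t \<Longrightarrow> P (Suc t)"
  shows "\<forall>\<^sub>F t in sequentially. P t"
proof -
  have "P t" if "\<tau> \<le> t" for t
    using that by (induction t rule: dec_induct) (use assms in auto)
  thus ?thesis by (auto simp: eventually_sequentially)
qed

locale asynchronous_run = weighted_team T w c
  for T :: "('x::polish_space, 'y, 'u::finite) team" and w c +
  fixes s :: "nat \<Rightarrow> nat \<Rightarrow> agent_state" and m0 :: "nat \<Rightarrow> nat \<Rightarrow> 'y \<Rightarrow> real ^ 'u"
    and \<gamma>s :: "nat \<Rightarrow> 'y \<Rightarrow> real ^ 'u"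
  assumes recurrent: "recurrent_schedule T s"
    and initial: "\<And>j. j \<in> agents T \<Longrightarrow> m0 j \<in> policy_profiles T"
    and limit_profile: "\<gamma>s \<in> policy_profiles T" and limit_fixed: "best_response_operator T \<gamma>s = \<gamma>s"
begin

abbreviation "m \<equiv> memory T s m0"

definition entry_close :: "real \<Rightarrow> nat \<Rightarrow> nat \<Rightarrow> nat \<Rightarrow> bool" where
  "entry_close M j i t \<longleftrightarrow> policy_close M i (m t j i) (\<gamma>s i)"

lemma memory_policy_profiles: "j \<in> agents T \<Longrightarrow> m t j \<in> policy_profiles T"
proof (induction t arbitrary: j)
  case (Suc t)
  have "m (Suc t) j i \<in> policies T i" if i: "i \<in> agents T" for i
  proof -
    have "m t k i \<in> policies T i" if "k \<in> agents T" for k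
      using Suc.IH[OF that] i unfolding policy_profiles_def by (rule PiE_mem)
    moreover have "best_response T j (restrict (m t j) (others T j)) \<in> policies T j"
      using Suc by (intro best_response_in_policies unique restrict_others_policies)
    ultimately show ?thesis using i Suc.prems by auto
  qed
  thus ?case unfolding policy_profiles_def by (intro PiE_I) auto
qed (simp add: initial)

lemma compute_close:
  assumes j: "j \<in> agents T" and M: "0 \<le> M" and comp: "computes_at s (Suc t) j"
    and close: "\<And>i. i \<in> agents T \<Longrightarrow> entry_close M j i t"
  shows "entry_close (c * M) j j (Suc t)"
proof -
  have "policy_close (c * M) j (best_response T j (restrict (m t j) (others T j)))
      (best_response T j (restrict \<gamma>s (others T j)))"
    using close others_agents unfolding entry_close_def
    by (intro best_response_close j M memory_policy_profiles limit_profile) auto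
  moreover have "best_response T j (restrict \<gamma>s (others T j)) = \<gamma>s j"
    using B_apply[OF j, of \<gamma>s] limit_fixed by simp
  ultimately show ?thesis using j comp by (simp add: entry_close_def)
qed

text \<open>
  One phase of the nested-box argument, with distances to the fixed point measured relative to
  the weights. Once every memory entry is within \<open>M\<close>, every computation puts the computing agent's own entry within \<open>c M\<close>, and the entry stays there through later
  recomputations. Once all own entries are within \<open>c M\<close>, every transmission spreads such an
  entry, and no later transmission can spoil it. The recurrence of the schedule makes both
  events happen.
\<close>

lemma eventually_memory_close_step:
  assumes M: "0 \<le> M"
    and close: "\<forall>\<^sub>F t in sequentially. \<forall>j\<in>agents T. \<forall>i\<in>agents T. entry_close M j i t"
  shows "\<forall>\<^sub>F t in sequentially. \<forall>j\<in>agents T. \<forall>i\<in>agents T. entry_close (c * M) j i t"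
proof -
  obtain t0 where t0: "\<And>t j i. t0 \<le> t \<Longrightarrow> j \<in> agents T \<Longrightarrow> i \<in> agents T \<Longrightarrow> entry_close M j i t"
    using close by (auto simp: eventually_sequentially)
  have own: "\<forall>\<^sub>F t in sequentially. entry_close (c * M) j j t" if j: "j \<in> agents T" for j
  proof -
    obtain \<tau> where "t0 < \<tau>" "computes_at s \<tau> j"
      using recurrent j unfolding recurrent_schedule_def by (metis greaterThanAtMost_iff)
    then obtain \<tau>' where \<tau>: "t0 \<le> \<tau>'" "computes_at s (Suc \<tau>') j"
      by (cases \<tau>) (auto simp: less_Suc_eq_le)
    show ?thesis
    proof (rule eventually_sequentially_persistent)
      show "entry_close (c * M) j j (Suc \<tau>')"
        using \<tau> t0[OF \<tau>(1) j] by (intro compute_close j M)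
      show "entry_close (c * M) j j (Suc t)" if "t0 \<le> t" "entry_close (c * M) j j t" for t
      proof (cases "computes_at s (Suc t) j")
        case True
        thus ?thesis using t0[OF that(1) j] by (intro compute_close j M)
      next
        case False
        thus ?thesis using that(2) j by (simp add: entry_close_def)
      qed
    qed (use \<tau> in simp)
  qed
  hence "\<forall>\<^sub>F t in sequentially. \<forall>j\<in>agents T. entry_close (c * M) j j t"
    by (intro eventually_ball_finite) auto
  then obtain t1 where t1: "\<And>t j. t1 \<le> t \<Longrightarrow> j \<in> agents T \<Longrightarrow> entry_close (c * M) j j t"
    by (auto simp: eventually_sequentially)
  have "\<forall>\<^sub>F t in sequentially. entry_close (c * M) j i t" if j: "j \<in> agents T" and i: "i \<in> agents T" for j i
  proof (cases "i = j")
    case True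
    thus ?thesis using own[OF j] by simp
  next
    case False
    hence "j \<in> others T i" using j by (simp add: others_def)
    then obtain \<tau> where "t1 < \<tau>" "transmits_at s \<tau> i j"
      using recurrent i unfolding recurrent_schedule_def by (metis greaterThanAtMost_iff)
    then obtain \<tau>' where \<tau>: "t1 \<le> \<tau>'" "transmits_at s (Suc \<tau>') i j"
      by (cases \<tau>) (auto simp: less_Suc_eq_le)
    show ?thesis
    proof (rule eventually_sequentially_persistent)
      show "entry_close (c * M) j i (Suc \<tau>')"
        using \<tau> t1[OF \<tau>(1) i] i False by (simp add: entry_close_def)
      show "entry_close (c * M) j i (Suc t)" if "t1 \<le> t" "entry_close (c * M) j i t" for t
        using t1[OF that(1) i] that(2) i False by (simp add: entry_close_def)
    qed (use \<tau> in simp)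
  qed
  thus ?thesis by (intro eventually_ball_finite ballI) auto
qed

lemma eventually_close:
  "\<forall>\<^sub>F t in sequentially. \<forall>j\<in>agents T. \<forall>i\<in>agents T. entry_close (2 * c ^ k) j i t"
proof (induction k)
  case 0
  show ?case
    by (intro always_eventually allI ballI)
      (simp add: entry_close_def policy_close_2 memory_policy_profiles limit_profile)
next
  case (Suc k)
  from eventually_memory_close_step[OF _ this] rate show ?case by (simp add: mult_ac)
qed

lemma policy_norm_close_le:
  assumes i: "i \<in> agents T" and close: "policy_close M i p p'"
  shows "policy_norm T i (\<lambda>b. p b - p' b) \<le> M * w i"
proof -
  have "policy_norm T i (\<lambda>b. p b - p' b) \<le> (\<Sum>b\<in>observations T i. (M * w i) * pmf (obs_dist T i) b)"
    unfolding policy_norm_def using close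
    by (intro sum_mono mult_right_mono) (auto simp: policy_close_def)
  also have "\<dots> = M * w i * (\<Sum>b\<in>observations T i. pmf (obs_dist T i) b)"
    by (simp add: sum_distrib_left)
  also have "(\<Sum>b\<in>observations T i. pmf (obs_dist T i) b) = 1"
    using team_model_finite[OF model i] by (intro sum_pmf_eq_1) (simp_all add: obs_dist_def)
  finally show ?thesis by simp
qed

lemma converges:
  assumes j: "j \<in> agents T"
  shows "(\<lambda>t. profile_norm T (\<lambda>i b. current_profile T s m0 t i b - \<gamma>s i b) j) \<longlonglongrightarrow> 0"
proof -
  define e where "e t = policy_norm T j (\<lambda>b. m t j j b - \<gamma>s j b)" for t
  have e: "profile_norm T (\<lambda>i b. current_profile T s m0 t i b - \<gamma>s i b) j = e t" for t
    using j by (simp add: profile_norm_def current_profile_def e_def)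
  have "e \<longlonglongrightarrow> 0"
  proof (rule order_tendstoI)
    fix a :: real assume "a < 0"
    moreover have "0 \<le> e t" for t
      unfolding e_def policy_norm_def by (intro sum_nonneg) simp
    ultimately show "\<forall>\<^sub>F t in sequentially. a < e t"
      by (intro always_eventually allI) (rule less_le_trans)
  next
    fix a :: real assume "0 < a"
    moreover have "(\<lambda>k. 2 * c ^ k * w j) \<longlonglongrightarrow> 0"
      using rate by (intro tendsto_mult_left_zero tendsto_mult_right_zero LIMSEQ_power_zero) auto
    ultimately have "\<forall>\<^sub>F k in sequentially. 2 * c ^ k * w j < a" by (rule order_tendstoD(2)[rotated])
    then obtain k where k: "2 * c ^ k * w j < a" by (auto simp: eventually_sequentially)
    show "\<forall>\<^sub>F t in sequentially. e t < a"
      using eventually_close[of k]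
    proof eventually_elim
      case (elim t)
      hence "e t \<le> 2 * c ^ k * w j"
        using j unfolding e_def entry_close_def by (intro policy_norm_close_le) auto
      with k show ?case by simp
    qed
  qed
  thus ?thesis unfolding e .
qed

end

theorem theorem2:
  fixes T :: "('x::polish_space, 'y, 'u::finite) team"
    and s :: "nat \<Rightarrow> nat \<Rightarrow> agent_state"
    and m0 :: "nat \<Rightarrow> nat \<Rightarrow> 'y \<Rightarrow> real ^ 'u"
  assumes "team_model T"
    and "regularized T"
    and "unique_best_responses T"
    and "spectral_radius (map_mat complex_of_real (sensitivity_matrix T)) < 1"
    and "valid_schedule T s"
    and "recurrent_schedule T s"
    and "\<forall>j\<in>agents T. m0 j \<in> policy_profiles T"
  shows "\<exists>\<gamma>s. {\<gamma> \<in> policy_profiles T. best_response_operator T \<gamma> = \<gamma>} = {\<gamma>s} \<and>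
           (\<forall>j\<in>agents T.
              (\<lambda>t. profile_norm T (\<lambda>i b. current_profile T s m0 t i b - \<gamma>s i b) j)
                \<longlonglongrightarrow> 0)"
proof -
  let ?P = "sensitivity_matrix T" and ?n = "num_agents T"
  have n: "?n > 0" using assms(1) by (simp add: team_model_def)
  have P: "?P \<in> carrier_mat ?n ?n" by (simp add: sensitivity_matrix_def)
  have nonneg: "0 \<le> ?P $$ (i, j)" if "i < ?n" "j < ?n" for i j
    using that reward_oscillation_nonneg[OF assms(1), of j] assms(2)
    by (auto simp: sensitivity_matrix_def agents_def regularized_def intro!: divide_nonneg_pos)
  obtain w c where wc: "\<And>i. i < ?n \<Longrightarrow> 1 \<le> w i" "0 \<le> c" "c < 1"
    "\<And>i. i < ?n \<Longrightarrow> (\<Sum>j<?n. ?P $$ (i, j) * w j) \<le> c * w i"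
    using spectral_radius_less_1_weights[OF P n nonneg assms(4)] by blast
  interpret weighted_team T w c
    using assms(1-3) wc by unfold_locales (simp_all add: agents_def)
  have "m0 0 \<in> policy_profiles T" using assms(7) n by (simp add: agents_def)
  then obtain \<gamma>s where \<gamma>s: "\<gamma>s \<in> policy_profiles T" "best_response_operator T \<gamma>s = \<gamma>s"
    using ex_fixed_point by blast
  interpret asynchronous_run T w c s m0 \<gamma>s
    using assms(6,7) \<gamma>s by unfold_locales auto
  have "{\<gamma> \<in> policy_profiles T. best_response_operator T \<gamma> = \<gamma>} = {\<gamma>s}"
    using \<gamma>s fixed_point_unique by blast
  with converges show ?thesis by blast
qed

end
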